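(* Let $p_G\in(0,1)$ and let $c$ be an arbitrary constant in the interval $(1,\frac{1}{p_G})$. Let $X_1,X_2,\dots$ be strictly positive i.i.d. random variables, and let $I_{A_1},I_{A_2},\dots$ be i.i.d. Bernoulli random variables with $$\mathbb{P}(A_1)=\mathbb{P}(I_{A_1}=1)=\frac{1-cp_G}{c(1-p_G)}.$$ Let $\xi,\eta$ be random variables with $$\mathbb{P}(\xi=k)=(1-cp_G)(cp_G)^k,\qquad \mathbb{P}(\eta=k)=(1-p_G)p_G^k,\qquad k=0,1,\dots,$$ and assume that all these random variables are independent. Then, with the convention $\sum_{i=1}^0:=0$, $$\sum_{i=1}^{\eta}X_i\stackrel{d}{=}\sum_{i=1}^{\xi}I_{A_i}X_i .$$
   Context: $\stackrel{d}{=}$ denotes equality in distribution. *)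

theory Defs
  imports "HOL-Probability.Probability"
begin

text \<open>
  Independence of a mixed family: \<^const>\<open>prob_space.indep_vars\<close> needs a common value type, so
  the \<^typ>\<open>nat\<close>-valued counts are embedded into the reals, which does not change the
  sigma-algebras they generate.
\<close>

datatype var_index = Summand nat | Mark nat | Count_xi | Count_eta

definition var_indices :: "var_index set" where
  "var_indices = Summand ` {1..} \<union> Mark ` {1..} \<union> {Count_xi, Count_eta}"

fun joint_family ::
  "(nat \<Rightarrow> 'a \<Rightarrow> real) \<Rightarrow> (nat \<Rightarrow> 'a set) \<Rightarrow> ('a \<Rightarrow> nat) \<Rightarrow> ('a \<Rightarrow> nat) \<Rightarrow> var_index \<Rightarrow> 'a \<Rightarrow> real"
where
  "joint_family X A \<xi> \<eta> (Summand i) = X i"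
| "joint_family X A \<xi> \<eta> (Mark i) = indicator (A i)"
| "joint_family X A \<xi> \<eta> Count_xi = (\<lambda>\<omega>. real (\<xi> \<omega>))"
| "joint_family X A \<xi> \<eta> Count_eta = (\<lambda>\<omega>. real (\<eta> \<omega>))"

end

theory Submission
  imports Defs
begin

text \<open>
  By Levy's uniqueness theorem it suffices to compare characteristic functions. If \<open>\<phi>\<close> is that of
  the \<open>X i\<close> and \<open>q\<close> is the probability of the \<open>A i\<close>, then the marked summands have characteristic
  function \<open>1 - q + q \<phi>\<close>, and a sum of a geometric(\<open>p\<close>) number of independent terms with
  characteristic function \<open>\<psi>\<close> has characteristic function \<open>(1 - p) / (1 - p \<psi>)\<close>. The value
  of \<open>q\<close> is the one for which \<open>(1 - c p) / (1 - c p (1 - q + q \<phi>)) = (1 - p) / (1 - p \<phi>)\<close>.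
\<close>

text \<open>Grouping principle: restrictions of an independent family to disjoint index blocks are
  independent, and applying a measurable function to each block keeps them so. It serves to regroup
  \<open>joint_family\<close> into counts and (marked) summands.\<close>

lemma (in prob_space) indep_vars_blocks:
  assumes "indep_vars M' X I" "\<And>j. j \<in> L \<Longrightarrow> K j \<subseteq> I" "disjoint_family_on K L"
    and "\<And>j. j \<in> L \<Longrightarrow> g j \<in> measurable (PiM (K j) M') (N j)"
  shows "indep_vars N (\<lambda>j \<omega>. g j (restrict (\<lambda>i. X i \<omega>) (K j))) L"
  by (rule indep_vars_compose2[OF indep_vars_restrict[OF assms(1-3)] assms(4)])

lemma (in prob_space) indep_vars_imp_indep_var:
  fixes X :: "'i \<Rightarrow> 'a \<Rightarrow> real"
  assumes "indep_vars (\<lambda>_. borel) X I" "i \<in> I" "j \<in> I" "i \<noteq> j"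
  shows "indep_var borel (X i) borel (X j)"
proof -
  have "indep_vars (\<lambda>_. borel) X (insert i {j})"
    by (rule indep_vars_subset[OF assms(1)]) (use assms in auto)
  \<comment> \<open>Independence of one variable from a finite sum of the others, applied to the
    one-term sum over \<open>{j}\<close>.\<close>
  from indep_vars_sum[OF _ _ this] assms(4) show ?thesis by simp
qed

text \<open>The indicator takes only the values 0 and 1, so
  \<open>iexp (t * (indicator A \<omega> * X \<omega>))\<close> is affine in it: 1 off
  \<open>A\<close> and \<open>iexp (t * X \<omega>)\<close> on \<open>A\<close>. Independence then
  factors the expectation of the product.\<close>

lemma (in prob_space) char_distr_indicator_mult:
  fixes X :: "'a \<Rightarrow> real"
  assumes A: "A \<in> events" and X: "random_variable borel X"
    and indep: "indep_var borel (indicator A :: 'a \<Rightarrow> real) borel X"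
  shows "char (distr M borel (\<lambda>\<omega>. indicator A \<omega> * X \<omega>)) t
    = of_real (1 - prob A) + of_real (prob A) * char (distr M borel X) t"
proof -
  note [measurable] = A X
  have int: "integrable M (\<lambda>\<omega>. complex_of_real (indicator A \<omega>))"
    by (rule integrable_of_real) (simp add: emeasure_eq_measure)
  have intX: "integrable M (\<lambda>\<omega>. iexp (t * X \<omega>))"
    by (rule integrable_iexp) auto
  have ind: "indep_var borel (\<lambda>\<omega>. complex_of_real (indicator A \<omega>)) borel (\<lambda>\<omega>. iexp (t * X \<omega>))"
    using indep_var_compose[OF indep, of complex_of_real borel "\<lambda>x. iexp (t * x)" borel]
    by (simp add: comp_def)
  have "char (distr M borel (\<lambda>\<omega>. indicator A \<omega> * X \<omega>)) t
    = (CLINT \<omega>|M. iexp (t * (indicator A \<omega> * X \<omega>)))"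
    by (simp add: char_def integral_distr)
  also have "\<dots> = (CLINT \<omega>|M. (1 - complex_of_real (indicator A \<omega>))
      + complex_of_real (indicator A \<omega>) * iexp (t * X \<omega>))"
    by (intro Bochner_Integration.integral_cong) (auto split: split_indicator)
  also have "\<dots> = (1 - of_real (prob A))
      + of_real (prob A) * (CLINT \<omega>|M. iexp (t * X \<omega>))"
    using int intX indep_var_integrable[OF ind int intX] A sets.sets_into_space[OF A]
    by (simp add: indep_var_lebesgue_integral[OF ind int intX] prob_space Int_absorb2
      del: of_real_mult)
  finally show ?thesis
    by (simp add: char_def integral_distr)
qed

text \<open>Split the expectation according to the value of \<open>N\<close>; each piece factors by
  independence. The sums start at index 1, so slot 0 is free to hold the count: the updated family
  expresses in one statement that \<open>N\<close> and all the terms are jointly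
  independent.\<close>

lemma (in prob_space) char_distr_random_sum:
  fixes Y :: "nat \<Rightarrow> 'a \<Rightarrow> real" and N :: "'a \<Rightarrow> nat"
  assumes N: "N \<in> measurable M (count_space UNIV)"
    and indep: "indep_vars (\<lambda>_. borel) (Y(0 := \<lambda>\<omega>. real (N \<omega>))) UNIV"
    and char_Y: "\<And>i. i \<ge> 1 \<Longrightarrow> char (distr M borel (Y i)) t = z"
  shows "(\<lambda>k. of_real (prob {\<omega> \<in> space M. N \<omega> = k}) * z ^ k)
    sums char (distr M borel (\<lambda>\<omega>. \<Sum>i=1..N \<omega>. Y i \<omega>)) t"
proof -
  note [measurable] = N
  let ?S = "\<lambda>k \<omega>. \<Sum>i=1..k. Y i \<omega>"
  \<comment> \<open>The contribution of the event \<open>N = k\<close>, on which the random sum has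
    the fixed length \<open>k\<close>.\<close>
  define f where "f k \<omega> = complex_of_real (indicator {k} (N \<omega>)) * iexp (t * ?S k \<omega>)" for k \<omega>
  have Y [measurable]: "random_variable borel (Y i)" if "i \<ge> 1" for i
    using indep that unfolding indep_vars_def by (auto dest!: spec[of _ i])
  have S [measurable]: "random_variable borel (?S k)" for k
    by (intro borel_measurable_sum) auto
  have SN [measurable]: "random_variable borel (\<lambda>\<omega>. ?S (N \<omega>) \<omega>)"
    by (rule measurable_compose_countable[OF S N])
  have int_ind: "integrable M (\<lambda>\<omega>. complex_of_real (indicator {k} (N \<omega>)))" for k
  proof (rule integrable_const_bound[where B = 1])
    show "random_variable borel (\<lambda>\<omega>. complex_of_real (indicator {k} (N \<omega>)))"
      by (rule measurable_compose[OF N]) simp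
  qed (auto split: split_indicator)
  have int_exp: "integrable M (\<lambda>\<omega>. iexp (t * ?S k \<omega>))" for k
    by (rule integrable_iexp) auto
  have ind: "indep_var borel (\<lambda>\<omega>. complex_of_real (indicator {k} (N \<omega>)))
      borel (\<lambda>\<omega>. iexp (t * ?S k \<omega>))" for k
  proof -
    have "indep_vars (\<lambda>_. borel) (Y(0 := \<lambda>\<omega>. real (N \<omega>))) (insert 0 {1..k})"
      by (rule indep_vars_subset[OF indep]) auto
    from indep_vars_sum[OF _ _ this]
    have "indep_var borel (\<lambda>\<omega>. real (N \<omega>)) borel (?S k)"
      by simp
    \<comment> \<open>The independence concerns \<open>real (N \<omega>)\<close>; since
      \<open>real\<close> is injective, the indicator of \<open>{real k}\<close> recovers the event
      \<open>N = k\<close>.\<close>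
    from indep_var_compose[OF this, of "\<lambda>x. complex_of_real (indicator {real k} x)" borel
        "\<lambda>x. iexp (t * x)" borel]
    show ?thesis by (simp add: comp_def indicator_def)
  qed
  have prob_N: "(LINT \<omega>|M. indicator {k} (N \<omega>)) = prob {\<omega> \<in> space M. N \<omega> = k}" for k
  proof -
    have "(LINT \<omega>|M. indicator {k} (N \<omega>))
      = (LINT \<omega>|M. indicat_real {\<omega> \<in> space M. N \<omega> = k} \<omega>)"
      by (intro Bochner_Integration.integral_cong) (auto split: split_indicator)
    then show ?thesis by (simp add: Int_absorb2 subset_eq)
  qed
  have int_f: "integrable M (f k)" for k
    unfolding f_def by (rule indep_var_integrable[OF ind int_ind int_exp])
  have norm_f: "(\<integral>\<omega>. norm (f k \<omega>) \<partial>M) = prob {\<omega> \<in> space M. N \<omega> = k}" for k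
    by (simp add: f_def norm_mult prob_N del: of_real_mult of_real_sum)
  have integral_f: "(\<integral>\<omega>. f k \<omega> \<partial>M) = of_real (prob {\<omega> \<in> space M. N \<omega> = k}) * z ^ k" for k
  proof -
    have "indep_vars (\<lambda>_. borel) (Y(0 := \<lambda>\<omega>. real (N \<omega>))) {1..k}"
      by (rule indep_vars_subset[OF indep]) auto
    then have "indep_vars (\<lambda>_. borel) Y {1..k}"
      by (subst (asm) indep_vars_cong) auto
    then have "char (distr M borel (?S k)) t = z ^ k"
      by (simp add: char_distr_sum char_Y)
    then have "(\<integral>\<omega>. iexp (t * ?S k \<omega>) \<partial>M) = z ^ k"
      by (simp add: char_def integral_distr)
    then show ?thesis
      unfolding f_def indep_var_lebesgue_integral[OF ind int_ind int_exp] by (simp add: prob_N)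
  qed
  \<comment> \<open>For fixed \<open>\<omega>\<close> only the term \<open>k = N \<omega>\<close> is
    nonzero, so pointwise convergence is trivial.\<close>
  have f_sums: "(\<lambda>k. f k \<omega>) sums iexp (t * ?S (N \<omega>) \<omega>)" for \<omega>
    using sums_finite[of "{N \<omega>}" "\<lambda>k. f k \<omega>"] by (simp add: f_def)
  have summable_f: "summable (\<lambda>k. norm (f k \<omega>))" for \<omega>
    by (rule summable_finite[of "{N \<omega>}"]) (auto simp: f_def)
  \<comment> \<open>Justifies exchanging sum and integral: \<open>iexp\<close> has modulus 1, so the
    expected norm of \<open>f k\<close> is the probability of \<open>N = k\<close>, and these
    probabilities of disjoint events are summable.\<close>
  have "(\<lambda>k. prob {\<omega> \<in> space M. N \<omega> = k}) sums prob (\<Union>k. {\<omega> \<in> space M. N \<omega> = k})"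
    by (rule finite_measure_UNION) (auto simp: disjoint_family_on_def)
  then have "summable (\<lambda>k. \<integral>\<omega>. norm (f k \<omega>) \<partial>M)"
    by (simp add: norm_f sums_iff)
  from sums_integral[OF int_f AE_I2[OF summable_f] this]
  have "(\<lambda>k. \<integral>\<omega>. f k \<omega> \<partial>M) sums (\<integral>\<omega>. iexp (t * ?S (N \<omega>) \<omega>) \<partial>M)"
    using sums_unique[OF f_sums] by simp
  then show ?thesis
    by (simp add: integral_f char_def integral_distr del: of_real_mult of_real_sum)
qed

text \<open>With geometric weights the series of the previous lemma is a geometric series of ratio
  \<open>p * z\<close>. It converges because a characteristic function has modulus at most 1 and
  \<open>p < 1\<close>.\<close>

lemma (in prob_space) char_distr_geometric_sum:
  fixes Y :: "nat \<Rightarrow> 'a \<Rightarrow> real" and N :: "'a \<Rightarrow> nat" and p :: real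
  assumes N: "N \<in> measurable M (count_space UNIV)"
    and indep: "indep_vars (\<lambda>_. borel) (Y(0 := \<lambda>\<omega>. real (N \<omega>))) UNIV"
    and char_Y: "\<And>i. i \<ge> 1 \<Longrightarrow> char (distr M borel (Y i)) t = z"
    and N_dist: "\<And>k. prob {\<omega> \<in> space M. N \<omega> = k} = (1 - p) * p ^ k"
    and p: "0 \<le> p" "p < 1"
  shows "char (distr M borel (\<lambda>\<omega>. \<Sum>i=1..N \<omega>. Y i \<omega>)) t = (1 - of_real p) / (1 - of_real p * z)"
proof -
  have Y: "random_variable borel (Y 1)"
    using indep unfolding indep_vars_def by (auto dest!: spec[of _ 1])
  have "norm z \<le> 1"
    using real_distribution.cmod_char_le_1[OF real_distribution_distr[OF Y], of t] char_Y[of 1]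
    by simp
  then have "norm (of_real p * z) \<le> p"
    using p by (simp add: norm_mult mult_left_le)
  then have norm: "norm (of_real p * z) < 1"
    using p by simp
  have "(\<lambda>k. (1 - of_real p) * (of_real p * z) ^ k) sums ((1 - of_real p) * (1 / (1 - of_real p * z)))"
    by (intro sums_mult geometric_sums norm)
  then have "(\<lambda>k. of_real (prob {\<omega> \<in> space M. N \<omega> = k}) * z ^ k)
      sums ((1 - of_real p) / (1 - of_real p * z))"
    by (simp add: N_dist power_mult_distrib mult.assoc)
  from sums_unique2[OF char_distr_random_sum[OF N indep char_Y] this]
  show "char (distr M borel (\<lambda>\<omega>. \<Sum>i=1..N \<omega>. Y i \<omega>)) t = (1 - of_real p) / (1 - of_real p * z)"
    by simp
qed

theorem lemma1:
  fixes M :: "'a measure" and p\<^sub>G c :: real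
    and X :: "nat \<Rightarrow> 'a \<Rightarrow> real" and A :: "nat \<Rightarrow> 'a set"
    and \<xi> \<eta> :: "'a \<Rightarrow> nat"
  assumes "prob_space M"
    and "0 < p\<^sub>G" and "p\<^sub>G < 1"
    and "1 < c" and "c < 1 / p\<^sub>G"
    and X_rv: "\<And>i. i \<ge> 1 \<Longrightarrow> X i \<in> borel_measurable M"
    and X_pos: "\<And>i. i \<ge> 1 \<Longrightarrow> AE \<omega> in M. X i \<omega> > 0"
    and X_ident: "\<And>i. i \<ge> 1 \<Longrightarrow> distr M borel (X i) = distr M borel (X 1)"
    and A_event: "\<And>i. i \<ge> 1 \<Longrightarrow> A i \<in> sets M"
    and A_prob: "\<And>i. i \<ge> 1 \<Longrightarrow> measure M (A i) = (1 - c * p\<^sub>G) / (c * (1 - p\<^sub>G))"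
    and \<xi>_rv: "\<xi> \<in> measurable M (count_space UNIV)"
    and \<xi>_dist: "\<And>k. measure M {\<omega> \<in> space M. \<xi> \<omega> = k} = (1 - c * p\<^sub>G) * (c * p\<^sub>G) ^ k"
    and \<eta>_rv: "\<eta> \<in> measurable M (count_space UNIV)"
    and \<eta>_dist: "\<And>k. measure M {\<omega> \<in> space M. \<eta> \<omega> = k} = (1 - p\<^sub>G) * p\<^sub>G ^ k"
    and indep: "prob_space.indep_vars M (\<lambda>_. borel) (joint_family X A \<xi> \<eta>) var_indices"
  shows "distr M borel (\<lambda>\<omega>. \<Sum>i=1..\<eta> \<omega>. X i \<omega>)
       = distr M borel (\<lambda>\<omega>. \<Sum>i=1..\<xi> \<omega>. indicator (A i) \<omega> * X i \<omega>)"
proof -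
  interpret prob_space M by fact
  let ?J = "joint_family X A \<xi> \<eta>"
  define q where "q = (1 - c * p\<^sub>G) / (c * (1 - p\<^sub>G))"
  define Y where "Y i \<omega> = indicator (A i) \<omega> * X i \<omega>" for i \<omega>
  have cp: "0 \<le> c * p\<^sub>G" "c * p\<^sub>G < 1"
    using assms(2-5) by (auto simp: field_simps)
  have Y_meas: "random_variable borel (Y i)" if "i \<ge> 1" for i
    unfolding Y_def using A_event[OF that] X_rv[OF that] by measurable

  have indep_X: "indep_vars (\<lambda>_. borel) (X(0 := \<lambda>\<omega>. real (\<eta> \<omega>))) UNIV"
  proof -
    \<comment> \<open>Singleton blocks: this only reindexes the joint family by \<open>nat\<close>,
      with the count in slot 0.\<close>
    define K where "K j = (if j = 0 then {Count_eta} else {Summand j})" for j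
    define g where "g j f = (f (if j = 0 then Count_eta else Summand j) :: real)" for j f
    have "indep_vars (\<lambda>_. borel) (\<lambda>j \<omega>. g j (restrict (\<lambda>i. ?J i \<omega>) (K j))) UNIV"
    proof (rule indep_vars_blocks[OF indep])
      show "g j \<in> measurable (PiM (K j) (\<lambda>_. borel)) borel" for j
        unfolding g_def K_def by (cases "j = 0") auto
    qed (auto simp: K_def var_indices_def disjoint_family_on_def)
    also have "(\<lambda>j \<omega>. g j (restrict (\<lambda>i. ?J i \<omega>) (K j))) = X(0 := \<lambda>\<omega>. real (\<eta> \<omega>))"
      by (auto simp: fun_eq_iff g_def K_def)
    finally show ?thesis .
  qed

  have indep_Y: "indep_vars (\<lambda>_. borel) (Y(0 := \<lambda>\<omega>. real (\<xi> \<omega>))) UNIV"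
  proof -
    \<comment> \<open>Here each mark shares a block with its own summand, and \<open>g\<close>
      multiplies the two; the blocks stay disjoint, so the marked summands and \<open>\<xi>\<close>
      are jointly independent.\<close>
    define K where "K j = (if j = 0 then {Count_xi} else {Mark j, Summand j})" for j
    define g where "g j f = (if j = 0 then f Count_xi else f (Mark j) * f (Summand j) :: real)" for j f
    have "indep_vars (\<lambda>_. borel) (\<lambda>j \<omega>. g j (restrict (\<lambda>i. ?J i \<omega>) (K j))) UNIV"
    proof (rule indep_vars_blocks[OF indep])
      show "g j \<in> measurable (PiM (K j) (\<lambda>_. borel)) borel" for j
        unfolding g_def K_def by (cases "j = 0") auto
    qed (auto simp: K_def var_indices_def disjoint_family_on_def)
    also have "(\<lambda>j \<omega>. g j (restrict (\<lambda>i. ?J i \<omega>) (K j))) = Y(0 := \<lambda>\<omega>. real (\<xi> \<omega>))"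
      by (auto simp: fun_eq_iff g_def K_def Y_def)
    finally show ?thesis .
  qed

  have char_eq: "char (distr M borel (\<lambda>\<omega>. \<Sum>i=1..\<eta> \<omega>. X i \<omega>)) t
      = char (distr M borel (\<lambda>\<omega>. \<Sum>i=1..\<xi> \<omega>. Y i \<omega>)) t" for t
  proof -
    define z where "z = char (distr M borel (X 1)) t"
    have char_X: "char (distr M borel (X i)) t = z" if "i \<ge> 1" for i
      using X_ident[OF that] by (simp add: z_def)
    have char_Y: "char (distr M borel (Y i)) t = of_real (1 - q) + of_real q * z" if "i \<ge> 1" for i
    proof -
      have "indep_var borel (?J (Mark i)) borel (?J (Summand i))"
        by (rule indep_vars_imp_indep_var[OF indep]) (use that in \<open>auto simp: var_indices_def\<close>)
      then have "indep_var borel (indicator (A i)) borel (X i)"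
        by simp
      from char_distr_indicator_mult[OF A_event[OF that] X_rv[OF that] this, of t]
      show ?thesis
        by (simp add: char_X[OF that] A_prob[OF that] q_def Y_def[abs_def])
    qed
    define r where "r = c * p\<^sub>G"
    \<comment> \<open>The factor \<open>c\<close> in \<open>r\<close> cancels the one in the
      denominator of \<open>q\<close>, leaving \<open>1 - r\<close> as a factor.\<close>
    have "r * q = p\<^sub>G * (1 - r) / (1 - p\<^sub>G)"
      using assms(2-5) by (simp add: q_def r_def)
    from arg_cong[OF this, of complex_of_real]
    have rq: "complex_of_real r * of_real q = of_real p\<^sub>G * (1 - of_real r) / (1 - of_real p\<^sub>G)"
      by simp
    have p1: "1 - complex_of_real p\<^sub>G \<noteq> 0"
      using \<open>p\<^sub>G < 1\<close> of_real_eq_1_iff[of p\<^sub>G, where 'a = complex] by auto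
    have r1: "1 - complex_of_real r \<noteq> 0"
      using cp of_real_eq_1_iff[of r, where 'a = complex] by (auto simp: r_def)
    \<comment> \<open>Isolating \<open>r * q\<close> lets the previous identity be substituted. Both
      summands then contain \<open>1 - r\<close>, which later cancels against the numerator of the
      characteristic function of the marked sum.\<close>
    have "1 - complex_of_real r * (of_real (1 - q) + of_real q * z)
        = 1 - of_real r + complex_of_real r * of_real q * (1 - z)"
      by (simp add: algebra_simps)
    also have "\<dots> = (1 - of_real r) * (1 - of_real p\<^sub>G * z) / (1 - of_real p\<^sub>G)"
      unfolding rq using p1 by (simp add: divide_simps) (simp add: algebra_simps)
    finally have "(1 - complex_of_real r) / (1 - complex_of_real r * (of_real (1 - q) + of_real q * z))
        = (1 - of_real p\<^sub>G) / (1 - of_real p\<^sub>G * z)"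
      using r1 by simp
    then show ?thesis
      using char_distr_geometric_sum[OF \<eta>_rv indep_X char_X \<eta>_dist less_imp_le[OF \<open>0 < p\<^sub>G\<close>] \<open>p\<^sub>G < 1\<close>]
        char_distr_geometric_sum[OF \<xi>_rv indep_Y char_Y \<xi>_dist cp]
      unfolding r_def by metis
  qed

  have "distr M borel (\<lambda>\<omega>. \<Sum>i=1..\<eta> \<omega>. X i \<omega>) = distr M borel (\<lambda>\<omega>. \<Sum>i=1..\<xi> \<omega>. Y i \<omega>)"
  proof (rule Levy_uniqueness)
    show "real_distribution (distr M borel (\<lambda>\<omega>. \<Sum>i=1..\<eta> \<omega>. X i \<omega>))"
      \<comment> \<open>The random sum is measurable because the count is a measurable variable with
        countably many values and every sum of fixed length is measurable.\<close>
      by (rule real_distribution_distr, rule measurable_compose_countable[OF _ \<eta>_rv],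
          rule borel_measurable_sum) (simp add: X_rv)
    show "real_distribution (distr M borel (\<lambda>\<omega>. \<Sum>i=1..\<xi> \<omega>. Y i \<omega>))"
      by (rule real_distribution_distr, rule measurable_compose_countable[OF _ \<xi>_rv],
          rule borel_measurable_sum) (simp add: Y_meas)
  qed (rule ext, rule char_eq)
  then show ?thesis by (simp add: Y_def)
qed

end
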